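(* Let $n\ge 2$ and let $\boldsymbol{T}$ be a symmetric, honest and frugal $n$-player tournament. Then for any $P\in\mathcal{D}_n$, $\boldsymbol{wv}(\boldsymbol{T},P)\in\mathcal{A}_n^*$, where $\mathcal{A}_n^*$ is the convex hull of the vectors $v(G)$, $G\in\mathcal{G}_n$.
   Context: Write $[n]=\{1,\dots,n\}$ for the set of players. Let $\mathcal{M}_n=\{P=(p_{ij})\in[0,1]^{n\times n}: P+P^T=\mathbf{1}\}$, where $\mathbf{1}$ is the all-ones matrix (so $p_{ij}+p_{ji}=1$ and $p_{ii}=\frac12$). A matrix $P\in\mathcal{M}_n$ is doubly monotonic if $p_{ij}$ is (weakly) decreasing in $i$ and (weakly) increasing in $j$; $\mathcal{D}_n$ is the set of doubly monotonic $P\in\mathcal{M}_n$. An $n$-player tournament $\boldsymbol{T}$ is a set of rules (a randomized algorithm) which, one match at a time, announces an unordered pair $\{i,j\}$ of distinct players who then play a match, receives as only information which of the two won (no draws), and eventually announces one of the $n$ players as tournament winner. The choice of the next pair, and of the winner, may depend on the results of earlier matches and on additional randomness. The number of matches is bounded by a constant depending only on $\boldsymbol{T}$. For $P\in\mathcal{M}_n$, the specialization $(\boldsymbol{T},P)$ is the random process in which every match between $i$ and $j$ is won by $i$ with probability $p_{ij}$, independently of the past; $\pi_i(P)$ is the probability that player $i$ wins the tournament, and $\boldsymbol{wv}(\boldsymbol{T},P)=(\pi_1(P),\dots,\pi_n(P))$. Symmetric: for every $P\in\mathcal{M}_n$, every permutation $\sigma$ of $[n]$ and every $i\in[n]$,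 $\pi_i(P)=\pi_{\sigma(i)}(Q)$, where $Q\in\mathcal{M}_n$ is defined by $q_{\sigma(i)\sigma(j)}=p_{ij}$. Honest: for every possible state of $\boldsymbol{T}$ in which $r\ge0$ matches have been played and a pair $\{i,j\}$ has just been announced for match $r+1$ (the state includes the results of the previous matches and all random choices already made by the rules), and every $P\in\mathcal{M}_n$, one has $\pi_i^+(P)\ge\pi_i^-(P)$, where $\pi_i^+(P)$ (resp. $\pi_i^-(P)$) is the probability that $i$ wins the tournament conditioned on the current state and on $i$ winning (resp. losing) match $r+1$, with all subsequent matches decided according to $P$. Frugal: the tournament always begins by choosing one player uniformly at random to exclude from participation; this player takes part in no matches, though he may still be announced as winner. $\mathcal{G}_n$ is the family of labelled digraphs (loops and multiple arcs allowed) on vertex set $\{1,\dots,n\}$ such that: (Rule 1) exactly two arcs go out from each vertex; (Rule 2) every arc $(i,j)$ (from $i$ to $j$) satisfies $j\le i$; (Rule 3) if $(i,j_1)$ and $(i,j_2)$ are the two outgoing arcs from $i$ and $j_1=j_2$, then $j_1=1$ or $j_1=i$. For $G\in\mathcal{G}_n$, $v(G)=(v_1,\dots,v_n)\in\mathbb{R}^n$ is given by $v_i=\frac{\mathrm{indeg}_G(i)}{2n}$, where each loop at $i$ counts once in the indegree of $i$. *)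

theory Defs
  imports "HOL-Probability.Probability" "HOL-Library.Multiset"
begin

text \<open>
  The players \<open>{1, \<dots>, n}\<close> are the elements of a finite linearly ordered type \<open>'n\<close>,
  with \<open>n = CARD('n)\<close> and player \<open>1\<close> being \<open>Min UNIV\<close>.
\<close>

section \<open>Matrices of winning probabilities\<close>

definition prob_matrices :: "(real ^ 'n ^ 'n) set" where
  "prob_matrices =
     {P. (\<forall>i j. 0 \<le> P $ i $ j \<and> P $ i $ j \<le> 1) \<and> P + transpose P = (\<chi> i j. 1)}"

definition doubly_monotonic :: "(real ^ 'n::{finite,linorder} ^ 'n::{finite,linorder}) set" where
  "doubly_monotonic = {P \<in> prob_matrices.
     (\<forall>i i' j. i \<le> i' \<longrightarrow> P $ i' $ j \<le> P $ i $ j) \<and>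
     (\<forall>i j j'. j \<le> j' \<longrightarrow> P $ i $ j \<le> P $ i $ j')}"

section \<open>Tournaments\<close>

text \<open>
  A randomized algorithm is the tree of everything that it may still do. In \<open>Play i j t u\<close> the
  pair \<open>{i, j}\<close> has just been announced; the algorithm continues with \<open>t\<close> if \<open>i\<close> wins the match
  and with \<open>u\<close> if \<open>j\<close> wins it. In \<open>Randomize p\<close> it draws its own continuation from \<open>p\<close>.
  A subtree thus determines the distribution of the future given the current state, which
  includes the match results and the random choices made so far.
\<close>

datatype 'p rules =
    Announce 'p
  | Play 'p 'p "'p rules" "'p rules"
  | Randomize "'p rules pmf"

inductive state :: "'p rules \<Rightarrow> 'p rules \<Rightarrow> bool" for T :: "'p rules" where
  start: "state T T"
| fst_wins: "state T (Play i j t u) \<Longrightarrow> state T t"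
| snd_wins: "state T (Play i j t u) \<Longrightarrow> state T u"
| random: "state T (Randomize p) \<Longrightarrow> t \<in> set_pmf p \<Longrightarrow> state T t"

inductive at_most_matches :: "nat \<Rightarrow> 'p rules \<Rightarrow> bool" where
  "at_most_matches m (Announce w)"
| "at_most_matches m t \<Longrightarrow> at_most_matches m u \<Longrightarrow> at_most_matches (Suc m) (Play i j t u)"
| "(\<And>t. t \<in> set_pmf p \<Longrightarrow> at_most_matches m t) \<Longrightarrow> at_most_matches m (Randomize p)"

definition tournament :: "'p rules \<Rightarrow> bool" where
  "tournament T \<longleftrightarrow>
     (\<forall>i j t u. state T (Play i j t u) \<longrightarrow> i \<noteq> j) \<and> (\<exists>m. at_most_matches m T)"

text \<open>
  The distribution of the tournament winner in the specialization \<open>(T, P)\<close>. The last equation is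
  \<open>winner P (Randomize p) = bind_pmf p (winner P)\<close> in the form accepted by primitive recursion.
\<close>

primrec winner :: "real ^ 'n ^ 'n \<Rightarrow> 'n::finite rules \<Rightarrow> 'n pmf" where
  "winner P (Announce w) = return_pmf w"
| "winner P (Play i j t u) =
     bind_pmf (bernoulli_pmf (P $ i $ j)) (\<lambda>i_wins. if i_wins then winner P t else winner P u)"
| "winner P (Randomize p) = join_pmf (map_pmf (winner P) p)"

definition win_prob :: "'n::finite rules \<Rightarrow> real ^ 'n ^ 'n \<Rightarrow> 'n \<Rightarrow> real" where
  "win_prob T P i = pmf (winner P T) i"

definition win_vector :: "'n::finite rules \<Rightarrow> real ^ 'n ^ 'n \<Rightarrow> real ^ 'n" where
  "win_vector T P = (\<chi> i. win_prob T P i)"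

definition symmetric :: "'n::finite rules \<Rightarrow> bool" where
  "symmetric T \<longleftrightarrow>
     (\<forall>P \<in> prob_matrices. \<forall>\<sigma>. bij \<sigma> \<longrightarrow>
        (\<forall>Q \<in> prob_matrices. (\<forall>i j. Q $ \<sigma> i $ \<sigma> j = P $ i $ j) \<longrightarrow>
           (\<forall>i. win_prob T P i = win_prob T Q (\<sigma> i))))"

text \<open>
  The announced pair is unordered, hence one inequality for each of its two members.
\<close>

definition honest :: "'n::finite rules \<Rightarrow> bool" where
  "honest T \<longleftrightarrow>
     (\<forall>i j t u. state T (Play i j t u) \<longrightarrow>
        (\<forall>P \<in> prob_matrices. win_prob t P i \<ge> win_prob u P i \<and> win_prob u P j \<ge> win_prob t P j))"

definition frugal :: "'n::finite rules \<Rightarrow> bool" where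
  "frugal T \<longleftrightarrow>
     (\<exists>R. T = Randomize (map_pmf R (pmf_of_set UNIV)) \<and>
        (\<forall>k i j t u. state (R k) (Play i j t u) \<longrightarrow> i \<noteq> k \<and> j \<noteq> k))"

section \<open>The digraphs and the polytope\<close>

text \<open>
  A digraph on the vertex set \<open>UNIV\<close> is given by its multiset of arcs; \<open>(i, j)\<close> is an arc from
  \<open>i\<close> to \<open>j\<close>.
\<close>

definition out_arcs :: "('n \<times> 'n) multiset \<Rightarrow> 'n \<Rightarrow> ('n \<times> 'n) multiset" where
  "out_arcs G i = {#e \<in># G. fst e = i#}"

definition indeg :: "('n \<times> 'n) multiset \<Rightarrow> 'n \<Rightarrow> nat" where
  "indeg G i = size {#e \<in># G. snd e = i#}"

definition digraphs :: "('n::{finite,linorder} \<times> 'n) multiset set" where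
  "digraphs = {G.
     (\<forall>i. size (out_arcs G i) = 2) \<and>
     (\<forall>i j. (i, j) \<in># G \<longrightarrow> j \<le> i) \<and>
     (\<forall>i j1 j2. out_arcs G i = {#(i, j1), (i, j2)#} \<and> j1 = j2 \<longrightarrow> j1 = Min UNIV \<or> j1 = i)}"

definition digraph_vector :: "('n::finite \<times> 'n) multiset \<Rightarrow> real ^ 'n" where
  "digraph_vector G = (\<chi> i. real (indeg G i) / (2 * real CARD('n)))"

definition A_star :: "(real ^ 'n::{finite,linorder}) set" where
  "A_star = convex hull (digraph_vector ` digraphs)"

end

theory Submission
  imports Defs "HOL-Combinatorics.Transposition"
begin

text \<open>
  Let \<open>F k P i\<close> be the probability that \<open>i\<close> wins given that \<open>k\<close> is excluded, averaged over all
  relabellings of the players. By symmetry of the tournament the winning probability of \<open>i\<close> is the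
  mean of \<open>F k P i\<close> over \<open>k\<close>; by honesty \<open>F k P i\<close> is monotone in row \<open>i\<close> of \<open>P\<close>, and it does not
  depend on row \<open>k\<close>. Let \<open>i < j\<close>, so that \<open>i\<close> is the better player. Swapping \<open>i\<close> and \<open>j\<close> shows
  \<open>F i P j \<le> F j P i\<close>. Turning \<open>i\<close> into a copy of player \<open>1 \<noteq> i\<close> can only help \<open>i\<close>, and thereafter
  \<open>1\<close> and \<open>i\<close> are equally likely to win, so \<open>F j P i \<le> 1/2\<close>.

  View \<open>F k P i\<close> as mass moving from \<open>k\<close> to \<open>i\<close>. Cancelling the mass from \<open>i\<close> to \<open>j\<close> against that from
  \<open>j\<close> to \<open>i\<close>, and putting both on loops, changes no total and leaves from every \<open>j\<close> a distribution
  on \<open>{1, \<dots>, j}\<close> whose values strictly between \<open>1\<close> and \<open>j\<close> are at most \<open>1/2\<close>. For a given linear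
  functional, such a distribution is dominated by the best choice of two outgoing arcs at \<open>j\<close>
  allowed by Rules 2 and 3, so no hyperplane separates the win vector from the polytope.
\<close>

section \<open>Winning probabilities\<close>

lemma prob_matrices_iff:
  "P \<in> prob_matrices \<longleftrightarrow>
     (\<forall>i j. 0 \<le> P $ i $ j \<and> P $ i $ j \<le> 1) \<and> (\<forall>i j. P $ i $ j + P $ j $ i = 1)"
  by (auto simp: prob_matrices_def vec_eq_iff transpose_def)

lemma prob_matrices_diag:
  assumes "P \<in> prob_matrices"
  shows "P $ i $ i = 1/2"
proof -
  have "P $ i $ i + P $ i $ i = 1" using assms unfolding prob_matrices_iff by blast
  then show ?thesis by simp
qed

lemma win_prob_nonneg: "0 \<le> win_prob T P i"
  by (simp add: win_prob_def)

lemma sum_win_prob: "(\<Sum>i\<in>UNIV. win_prob T P i) = 1"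
  by (simp add: win_prob_def sum_pmf_eq_1)

lemma win_prob_Play:
  assumes "P \<in> prob_matrices"
  shows "win_prob (Play i j t u) P x =
           P $ i $ j * win_prob t P x + (1 - P $ i $ j) * win_prob u P x"
  using assms by (simp add: win_prob_def pmf_bind prob_matrices_iff)

lemma win_prob_Randomize:
  "win_prob (Randomize p) P x = measure_pmf.expectation p (\<lambda>t. win_prob t P x)"
  by (simp add: win_prob_def pmf_join)

lemma state_trans: "state t s \<Longrightarrow> state T t \<Longrightarrow> state T s"
  by (induction rule: state.induct) (auto intro: state.intros)

text \<open>Induction along the rules. Opponents of \<open>i\<close> are never \<open>k\<close>, so
  \<open>Q\<close> can only raise the chance that \<open>i\<close> wins a given match, and honesty
  makes that gain favourable; matches without \<open>i\<close> keep their probability.\<close>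

lemma win_prob_mono:
  assumes P: "P \<in> prob_matrices" and Q: "Q \<in> prob_matrices"
    and others: "\<And>a b. a \<notin> {i, k} \<Longrightarrow> b \<notin> {i, k} \<Longrightarrow> P $ a $ b = Q $ a $ b"
    and row: "\<And>b. b \<noteq> k \<Longrightarrow> P $ i $ b \<le> Q $ i $ b"
    and honest: "\<And>a b t u. state R (Play a b t u) \<Longrightarrow> a \<noteq> k \<and> b \<noteq> k \<and>
       win_prob u Q a \<le> win_prob t Q a \<and> win_prob t Q b \<le> win_prob u Q b"
  shows "win_prob R P i \<le> win_prob R Q i"
  using honest
proof (induction R)
  case (Announce w)
  then show ?case by (simp add: win_prob_def)
next
  case (Play a b t u)
  let ?p = "P $ a $ b" and ?q = "Q $ a $ b"
  have t: "win_prob t P i \<le> win_prob t Q i"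
    by (rule Play.IH(1)) (rule Play.prems, erule state_trans, rule state.fst_wins, rule state.start)
  have u: "win_prob u P i \<le> win_prob u Q i"
    by (rule Play.IH(2)) (rule Play.prems, erule state_trans, rule state.snd_wins, rule state.start)
  have h: "a \<noteq> k" "b \<noteq> k" "win_prob u Q a \<le> win_prob t Q a" "win_prob t Q b \<le> win_prob u Q b"
    using Play.prems[OF state.start] by auto
  have pq: "P $ a $ b + P $ b $ a = 1" "Q $ a $ b + Q $ b $ a = 1" "0 \<le> ?p" "?p \<le> 1"
    using P Q by (auto simp: prob_matrices_iff)
  \<comment> \<open>The change from \<open>P\<close> to \<open>Q\<close> is this product plus the
    changes inside both subtrees, weighted with \<open>?p\<close> and \<open>1 - ?p\<close>.\<close>
  have "0 \<le> (?q - ?p) * (win_prob t Q i - win_prob u Q i)"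
  proof -
    consider "a = i" | "b = i" | "a \<notin> {i, k}" "b \<notin> {i, k}"
      using h by auto
    then show ?thesis
    proof cases
      case 1
      then show ?thesis using h row[of b] by simp
    next
      case 2
      then show ?thesis using h row[of a] pq by (intro mult_nonpos_nonpos) auto
    next
      case 3
      then show ?thesis using others by simp
    qed
  qed
  moreover have "?p * win_prob t P i + (1 - ?p) * win_prob u P i
      \<le> ?p * win_prob t Q i + (1 - ?p) * win_prob u Q i"
    using t u pq by (intro add_mono mult_left_mono) auto
  ultimately show ?case
    by (simp add: win_prob_Play P Q algebra_simps)
next
  case (Randomize p)
  have int: "integrable (measure_pmf p) (\<lambda>t. win_prob t M i)" for M
    by (rule measure_pmf.integrable_const_bound[where B = 1]) (auto simp: win_prob_def pmf_nonneg intro: pmf_le_1)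
  have "win_prob t P i \<le> win_prob t Q i" if "t \<in> set_pmf p" for t
    by (rule Randomize.IH[OF that])
       (rule Randomize.prems, erule state_trans, rule state.random[OF state.start that])
  then show ?case
    unfolding win_prob_Randomize by (intro integral_mono_AE int) (simp add: AE_measure_pmf_iff)
qed

section \<open>Averaging over relabellings\<close>

text \<open>\<open>pull (inv \<sigma>) P\<close> is the relabelled matrix of
  \<open>symmetric\<close>. A non-injective \<open>c\<close> is useful too: it turns one player into
  a copy of another.\<close>

definition pull :: "('n \<Rightarrow> 'n) \<Rightarrow> real ^ 'n ^ 'n \<Rightarrow> real ^ 'n ^ 'n" where
  "pull c P = (\<chi> a b. P $ c a $ c b)"

lemma pull_nth [simp]: "pull c P $ a $ b = P $ c a $ c b"
  by (simp add: pull_def)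

lemma pull_pull: "pull c (pull d P) = pull (d \<circ> c) P"
  by (simp add: vec_eq_iff)

lemma pull_in_prob_matrices: "P \<in> prob_matrices \<Longrightarrow> pull c P \<in> prob_matrices"
  by (simp add: prob_matrices_iff)

text \<open>Symmetry constrains only the whole tournament, not the single branches
  \<open>R k\<close>. Moving excluded player, matrix and winner together by \<sigma> and averaging
  makes the branches equivariant.\<close>

definition avg_win_prob :: "('n \<Rightarrow> 'n::finite rules) \<Rightarrow> 'n \<Rightarrow> real ^ 'n ^ 'n \<Rightarrow> 'n \<Rightarrow> real" where
  "avg_win_prob R k P i =
     (\<Sum>\<sigma> | bij \<sigma>. win_prob (R (\<sigma> k)) (pull (inv \<sigma>) P) (\<sigma> i)) / real (card {\<sigma> :: 'n \<Rightarrow> 'n. bij \<sigma>})"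

lemma avg_win_prob_nonneg: "0 \<le> avg_win_prob R k P i"
  by (simp add: avg_win_prob_def sum_nonneg win_prob_nonneg)

lemma sum_avg_win_prob: "(\<Sum>i\<in>UNIV. avg_win_prob R k P i) = 1" for R :: "'n::finite \<Rightarrow> 'n rules"
proof -
  have "(\<Sum>i\<in>UNIV. win_prob (R (\<sigma> k)) (pull (inv \<sigma>) P) (\<sigma> i)) = 1" if "bij \<sigma>" for \<sigma>
    using sum.reindex_bij_betw[OF that, of "win_prob (R (\<sigma> k)) (pull (inv \<sigma>) P)"]
    by (simp add: sum_win_prob)
  then show ?thesis
    by (simp add: avg_win_prob_def flip: sum_divide_distrib)
       (subst sum.swap, use bij_id in auto)
qed

text \<open>Composition with \<tau> permutes the bijections, so the sum is merely reindexed.\<close>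

lemma avg_win_prob_relabel:
  fixes R :: "'n::finite \<Rightarrow> 'n rules"
  assumes \<tau>: "bij \<tau>"
  shows "avg_win_prob R (\<tau> k) (pull (inv \<tau>) P) (\<tau> i) = avg_win_prob R k P i"
proof -
  have "bij_betw (\<lambda>\<sigma>. \<sigma> \<circ> \<tau>) {\<sigma>. bij \<sigma>} {\<sigma>. bij \<sigma>}"
  proof (rule bij_betw_byWitness[where f' = "\<lambda>\<sigma>. \<sigma> \<circ> inv \<tau>"])
    show "\<forall>\<sigma>\<in>{\<sigma>. bij \<sigma>}. \<sigma> \<circ> \<tau> \<circ> inv \<tau> = \<sigma>"
      using \<tau> by (simp add: fun_eq_iff bij_is_surj surj_f_inv_f)
    show "\<forall>\<sigma>\<in>{\<sigma>. bij \<sigma>}. \<sigma> \<circ> inv \<tau> \<circ> \<tau> = \<sigma>"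
      using \<tau> by (simp add: fun_eq_iff bij_is_inj)
  qed (use \<tau> in \<open>auto intro: bij_comp bij_imp_bij_inv\<close>)
  from sum.reindex_bij_betw[OF this, of "\<lambda>\<sigma>. win_prob (R (\<sigma> k)) (pull (inv \<sigma>) P) (\<sigma> i)"]
  show ?thesis
    using \<tau> by (simp add: avg_win_prob_def pull_pull o_inv_distrib)
qed

lemma avg_win_prob_transpose:
  "avg_win_prob R (Transposition.transpose a b k) (pull (Transposition.transpose a b) P) (Transposition.transpose a b i) = avg_win_prob R k P i"
  for R :: "'n::finite \<Rightarrow> 'n rules"
  using avg_win_prob_relabel[OF bij_transpose, of R a b k P i] by simp

section \<open>Frugal tournaments\<close>

text \<open>\<open>R k\<close> is what a frugal tournament does after excluding \<open>k\<close>.\<close>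

locale honest_frugal =
  fixes R :: "'n::{finite,linorder} \<Rightarrow> 'n rules"
  assumes excluded: "state (R k) (Play i j t u) \<Longrightarrow> i \<noteq> k \<and> j \<noteq> k"
    and honest: "state (R k) (Play i j t u) \<Longrightarrow> P \<in> prob_matrices \<Longrightarrow>
      win_prob u P i \<le> win_prob t P i \<and> win_prob t P j \<le> win_prob u P j"
begin

text \<open>Each summand is a case of \<open>win_prob_mono\<close>. Nothing ties row
  \<open>k\<close> of \<open>P\<close> to that of \<open>Q\<close>, so a swap of \<open>i\<close>
  and \<open>k\<close>, which changes both rows, is covered.\<close>

lemma avg_win_prob_mono:
  assumes P: "P \<in> prob_matrices" and Q: "Q \<in> prob_matrices"
    and others: "\<And>a b. a \<notin> {i, k} \<Longrightarrow> b \<notin> {i, k} \<Longrightarrow> P $ a $ b = Q $ a $ b"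
    and row: "\<And>b. b \<noteq> k \<Longrightarrow> P $ i $ b \<le> Q $ i $ b"
  shows "avg_win_prob R k P i \<le> avg_win_prob R k Q i"
proof -
  have "win_prob (R (\<sigma> k)) (pull (inv \<sigma>) P) (\<sigma> i) \<le> win_prob (R (\<sigma> k)) (pull (inv \<sigma>) Q) (\<sigma> i)"
    if \<sigma>: "bij \<sigma>" for \<sigma>
  proof -
    have inv: "inv \<sigma> a \<noteq> x" if "a \<noteq> \<sigma> x" for a x
      using \<sigma> that by (metis bij_inv_eq_iff)
    show ?thesis
    proof (rule win_prob_mono)
      show "pull (inv \<sigma>) P $ a $ b = pull (inv \<sigma>) Q $ a $ b"
        if "a \<notin> {\<sigma> i, \<sigma> k}" "b \<notin> {\<sigma> i, \<sigma> k}" for a b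
        using that inv by (simp add: others)
      show "pull (inv \<sigma>) P $ \<sigma> i $ b \<le> pull (inv \<sigma>) Q $ \<sigma> i $ b" if "b \<noteq> \<sigma> k" for b
        using that inv \<sigma> by (simp add: row bij_is_inj)
    qed (use P Q excluded honest in \<open>auto simp: pull_in_prob_matrices\<close>)
  qed
  then show ?thesis
    unfolding avg_win_prob_def by (intro divide_right_mono sum_mono) auto
qed

lemma avg_win_prob_swap_le:
  assumes P: "P \<in> doubly_monotonic" and ij: "i < j"
  shows "avg_win_prob R i P j \<le> avg_win_prob R j P i"
proof -
  have PM: "P \<in> prob_matrices" and dec: "\<And>b. P $ j $ b \<le> P $ i $ b"
    using P ij by (auto simp: doubly_monotonic_def)
  note half = prob_matrices_diag[OF PM]
  have "avg_win_prob R i P j = avg_win_prob R j (pull (Transposition.transpose i j) P) i"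
    using avg_win_prob_transpose[of R i j i P j] by simp
  also have "\<dots> \<le> avg_win_prob R j P i"
  proof (rule avg_win_prob_mono)
    \<comment> \<open>Away from columns \<open>i\<close> and \<open>j\<close> this compares row
      \<open>j\<close> of \<open>P\<close> with row \<open>i\<close>; at \<open>b = i\<close> both
      entries are diagonal, hence 1/2.\<close>
    show "pull (Transposition.transpose i j) P $ i $ b \<le> P $ i $ b" if "b \<noteq> j" for b
      using that dec by (cases "b = i") (auto simp: half)
  qed (use PM in \<open>auto simp: pull_in_prob_matrices\<close>)
  finally show ?thesis .
qed

lemma avg_win_prob_le_half:
  assumes P: "P \<in> doubly_monotonic" and ij: "i < j" and i: "i \<noteq> Min UNIV"
  shows "avg_win_prob R j P i \<le> 1/2"
proof -
  define m :: 'n where "m = Min UNIV"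
  have m: "m \<le> a" for a by (simp add: m_def)
  have mi: "m < i" using i m[of i] by (simp add: m_def less_le)
  have PM: "P \<in> prob_matrices" and dec: "\<And>b. P $ i $ b \<le> P $ m $ b"
    using P m by (auto simp: doubly_monotonic_def)
  note half = prob_matrices_diag[OF PM]
  define Q where "Q = pull (\<lambda>a. if a = i then m else a) P"
  have QM: "Q \<in> prob_matrices" using PM by (simp add: Q_def pull_in_prob_matrices)
  have le: "avg_win_prob R j P i \<le> avg_win_prob R j Q i"
  proof (rule avg_win_prob_mono)
    show "P $ i $ b \<le> Q $ i $ b" if "b \<noteq> j" for b
      using dec by (simp add: Q_def half)
  qed (use PM QM in \<open>auto simp: Q_def\<close>)
  \<comment> \<open>In \<open>Q\<close> the players \<open>m\<close> and \<open>i\<close> are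
    indistinguishable. Their swap also fixes the excluded \<open>j\<close>, since
    \<open>m < i < j\<close>.\<close>
  have "pull (Transposition.transpose m i) Q = Q"
    using mi by (auto simp: vec_eq_iff Q_def Transposition.transpose_def)
  then have "avg_win_prob R j Q m = avg_win_prob R j Q i"
    using avg_win_prob_transpose[of R m i j Q i] mi ij by simp
  moreover have "avg_win_prob R j Q m + avg_win_prob R j Q i \<le> 1"
    using sum_mono2[of UNIV "{m, i}" "avg_win_prob R j Q"] mi
    by (simp add: sum_avg_win_prob avg_win_prob_nonneg)
  ultimately show ?thesis using le by simp
qed

end

section \<open>The win vector as a mean over the excluded player\<close>

lemma win_prob_frugal:
  fixes R :: "'n::finite \<Rightarrow> 'n rules"
  assumes "T = Randomize (map_pmf R (pmf_of_set UNIV))"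
  shows "win_prob T P i = (\<Sum>k\<in>UNIV. win_prob (R k) P i) / real CARD('n)"
  by (simp add: assms win_prob_Randomize integral_pmf_of_set)

text \<open>For fixed \<sigma>, the sum over all excluded players reassembles \<open>T\<close> on
  the relabelled matrix, where symmetry applies.\<close>

lemma win_prob_eq_avg:
  fixes R :: "'n::finite \<Rightarrow> 'n rules"
  assumes T: "T = Randomize (map_pmf R (pmf_of_set UNIV))"
    and "symmetric T" and P: "P \<in> prob_matrices"
  shows "win_prob T P i = (\<Sum>k\<in>UNIV. avg_win_prob R k P i) / real CARD('n)"
proof -
  have "(\<Sum>k\<in>UNIV. win_prob (R (\<sigma> k)) (pull (inv \<sigma>) P) (\<sigma> i)) = real CARD('n) * win_prob T P i"
    if \<sigma>: "bij \<sigma>" for \<sigma>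
  proof -
    have "win_prob T P i = win_prob T (pull (inv \<sigma>) P) (\<sigma> i)"
      using \<open>symmetric T\<close> P \<sigma> unfolding symmetric_def
      by (auto simp: pull_in_prob_matrices bij_is_inj)
    moreover have "(\<Sum>k\<in>UNIV. win_prob (R (\<sigma> k)) (pull (inv \<sigma>) P) (\<sigma> i)) =
        (\<Sum>k\<in>UNIV. win_prob (R k) (pull (inv \<sigma>) P) (\<sigma> i))"
      by (rule sum.reindex_bij_betw[OF \<sigma>])
    ultimately show ?thesis by (simp add: win_prob_frugal[OF T])
  qed
  then show ?thesis
    by (simp add: avg_win_prob_def flip: sum_divide_distrib)
       (subst sum.swap, use bij_id in auto)
qed

section \<open>The polytope\<close>

text \<open>Rule 1 holds by construction; \<open>f j = g j\<close> yields a double arc.\<close>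

definition arc_choice :: "('n::finite \<Rightarrow> 'n) \<Rightarrow> ('n \<Rightarrow> 'n) \<Rightarrow> ('n \<times> 'n) multiset" where
  "arc_choice f g = (\<Sum>j\<in>UNIV. {#(j, f j), (j, g j)#})"

lemma out_arcs_arc_choice: "out_arcs (arc_choice f g) i = {#(i, f i), (i, g i)#}"
proof -
  have "out_arcs (arc_choice f g) i = (\<Sum>j\<in>UNIV. {#e \<in># {#(j, f j), (j, g j)#}. fst e = i#})"
    unfolding out_arcs_def arc_choice_def
    by (rule sum_comp_morphism[unfolded comp_def, symmetric]) auto
  also have "\<dots> = (\<Sum>j\<in>UNIV. if j = i then {#(i, f i), (i, g i)#} else {#})"
    by (rule sum.cong) auto
  finally show ?thesis by simp
qed

lemma indeg_arc_choice:
  "real (indeg (arc_choice f g) i) = (\<Sum>j\<in>UNIV. of_bool (f j = i) + of_bool (g j = i))"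
proof -
  have "real (indeg (arc_choice f g) i) =
      (\<Sum>j\<in>UNIV. real (size {#e \<in># {#(j, f j), (j, g j)#}. snd e = i#}))"
    unfolding indeg_def arc_choice_def
    by (rule sum_comp_morphism[unfolded comp_def, symmetric]) auto
  then show ?thesis by (simp cong: sum.cong) (rule sum.cong, auto)
qed

text \<open>A linear functional splits into one term per vertex, so arcs can be optimised at each
  vertex separately.\<close>

lemma inner_digraph_vector_arc_choice:
  "w \<bullet> digraph_vector (arc_choice f g) =
     (\<Sum>j\<in>UNIV. (w $ f j + w $ g j) / 2) / real CARD('n)" for w :: "real ^ 'n::finite"
proof -
  have at: "(\<Sum>i\<in>UNIV. w $ i * of_bool (c = i)) = w $ c" for c
    by (simp add: of_bool_def if_distrib cong: if_cong)
  have "w \<bullet> digraph_vector (arc_choice f g) =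
      (\<Sum>i\<in>UNIV. \<Sum>j\<in>UNIV. w $ i * (of_bool (f j = i) + of_bool (g j = i))) / (2 * real CARD('n))"
    by (simp add: inner_vec_def digraph_vector_def indeg_arc_choice sum_distrib_left
        sum_divide_distrib)
  also have "\<dots> = (\<Sum>j\<in>UNIV. w $ f j + w $ g j) / (2 * real CARD('n))"
    by (subst sum.swap) (simp add: distrib_left sum.distrib at)
  finally show ?thesis by (simp flip: sum_divide_distrib)
qed

text \<open>Rules 2 and 3 at the single vertex \<open>j\<close>.\<close>

definition allowed_arcs :: "'n::{finite,linorder} \<Rightarrow> 'n \<Rightarrow> 'n \<Rightarrow> bool" where
  "allowed_arcs j a b \<longleftrightarrow> a \<le> j \<and> b \<le> j \<and> (a = b \<longrightarrow> a = Min UNIV \<or> a = j)"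

lemma arc_choice_in_digraphs:
  assumes "\<And>j. allowed_arcs j (f j) (g j)"
  shows "arc_choice f g \<in> digraphs"
proof -
  have "j = f i \<or> j = g i" if "(i, j) \<in># arc_choice f g" for i j
  proof -
    have "(i, j) \<in># out_arcs (arc_choice f g) i" using that by (simp add: out_arcs_def)
    then show ?thesis by (auto simp: out_arcs_arc_choice)
  qed
  moreover have "f i \<le> i" "g i \<le> i" for i
    using assms[of i] by (simp_all add: allowed_arcs_def)
  moreover have "j = Min UNIV \<or> j = i"
    if "{#(i, f i), (i, g i)#} = {#(i, j), (i, j)#}" for i j
    using arg_cong[OF that, of set_mset] assms[of i] by (auto simp: allowed_arcs_def)
  ultimately show ?thesis
    by (auto simp: digraphs_def out_arcs_arc_choice)
qed

text \<open>Let \<open>a\<close> maximise \<open>w\<close> up to \<open>j\<close>. If Rule 3 permits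
  a double arc to \<open>a\<close>, take it. Otherwise \<open>a\<close> carries mass at most 1/2,
  and the remaining mass is worth at most the runner-up \<open>b\<close>.\<close>

lemma ex_allowed_arcs_ge:
  fixes q w :: "'n::{finite,linorder} \<Rightarrow> real"
  assumes nonneg: "\<And>i. 0 \<le> q i" and supp: "\<And>i. j < i \<Longrightarrow> q i = 0" and sum: "(\<Sum>i\<in>UNIV. q i) = 1"
    and half: "\<And>i. i \<noteq> Min UNIV \<Longrightarrow> i < j \<Longrightarrow> q i \<le> 1/2"
  shows "\<exists>a b. allowed_arcs j a b \<and> (\<Sum>i\<in>UNIV. w i * q i) \<le> (w a + w b) / 2"
proof -
  have sum': "(\<Sum>i\<in>{..j}. q i) = 1"
    using sum by (subst sum.mono_neutral_left[of UNIV]) (auto simp: supp not_le)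
  have wq: "(\<Sum>i\<in>UNIV. w i * q i) = (\<Sum>i\<in>{..j}. w i * q i)"
    by (rule sum.mono_neutral_right) (auto simp: supp not_le)
  obtain a where a: "a \<le> j" "\<And>i. i \<le> j \<Longrightarrow> w i \<le> w a"
  proof -
    have "Max (w ` {..j}) \<in> w ` {..j}" by (rule Max_in) auto
    then obtain a where "Max (w ` {..j}) = w a" "a \<in> {..j}" by (rule imageE)
    moreover have "w i \<le> Max (w ` {..j})" if "i \<le> j" for i
      by (rule Max_ge) (use that in auto)
    ultimately show ?thesis using that by auto
  qed
  show ?thesis
  proof (cases "a = Min UNIV \<or> a = j")
    case True
    have "(\<Sum>i\<in>{..j}. w i * q i) \<le> (\<Sum>i\<in>{..j}. w a * q i)"
      using a nonneg by (intro sum_mono mult_right_mono) auto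
    then have "(\<Sum>i\<in>UNIV. w i * q i) \<le> (w a + w a) / 2"
      by (simp add: wq sum' flip: sum_distrib_left)
    moreover have "allowed_arcs j a a" using True a by (auto simp: allowed_arcs_def)
    ultimately show ?thesis by blast
  next
    case False
    \<comment> \<open>Hence \<open>{..j} - {a}\<close> contains \<open>j\<close>, and a runner-up
      exists.\<close>
    then have aj: "a < j" using a by (simp add: less_le)
    obtain b where b: "b \<le> j" "b \<noteq> a" "\<And>i. i \<le> j \<Longrightarrow> i \<noteq> a \<Longrightarrow> w i \<le> w b"
    proof -
      have "Max (w ` ({..j} - {a})) \<in> w ` ({..j} - {a})" by (rule Max_in) (use aj in auto)
      then obtain b where "Max (w ` ({..j} - {a})) = w b" "b \<in> {..j} - {a}" by (rule imageE)
      moreover have "w i \<le> Max (w ` ({..j} - {a}))" if "i \<le> j" "i \<noteq> a" for i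
        by (rule Max_ge) (use that in auto)
      ultimately show ?thesis using that by auto
    qed
    have rest: "(\<Sum>i\<in>{..j} - {a}. q i) = 1 - q a"
      using sum' a by (simp add: sum_diff1)
    have "(\<Sum>i\<in>{..j}. w i * q i) = w a * q a + (\<Sum>i\<in>{..j} - {a}. w i * q i)"
      using a by (simp add: sum.remove)
    also have "\<dots> \<le> w a * q a + (\<Sum>i\<in>{..j} - {a}. w b * q i)"
      using b nonneg by (intro add_left_mono sum_mono mult_right_mono) auto
    also have "\<dots> = w b + (w a - w b) * q a"
      by (simp add: rest flip: sum_distrib_left) (simp add: algebra_simps)
    also have "\<dots> \<le> w b + (w a - w b) * (1/2)"
      using half[of a] False aj a(2)[of b] b by (intro add_left_mono mult_left_mono) auto
    finally have "(\<Sum>i\<in>UNIV. w i * q i) \<le> (w a + w b) / 2"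
      unfolding wq by (simp add: field_simps)
    moreover have "allowed_arcs j a b" using a b by (auto simp: allowed_arcs_def)
    ultimately show ?thesis by blast
  qed
qed

lemma mean_in_A_star:
  fixes q :: "'n::{finite,linorder} \<Rightarrow> 'n \<Rightarrow> real" and v :: "real ^ 'n::{finite,linorder}"
  assumes nonneg: "\<And>j i. 0 \<le> q j i" and supp: "\<And>j i. j < i \<Longrightarrow> q j i = 0"
    and sum: "\<And>j. (\<Sum>i\<in>UNIV. q j i) = 1"
    and half: "\<And>j i. i \<noteq> Min UNIV \<Longrightarrow> i < j \<Longrightarrow> q j i \<le> 1/2"
    and v: "\<And>i. v $ i = (\<Sum>j\<in>UNIV. q j i) / real CARD('n)"
  shows "v \<in> A_star"
proof -
  let ?S = "(\<lambda>(f, g). digraph_vector (arc_choice f g)) ` {(f, g). \<forall>j::'n. allowed_arcs j (f j) (g j)}"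
  have "v \<in> convex hull ?S"
  proof (rule ccontr)
    assume "v \<notin> convex hull ?S"
    moreover have "closed (convex hull ?S)"
      by (intro compact_imp_closed finite_imp_compact_convex_hull finite_imageI finite)
    ultimately obtain w b where w: "w \<bullet> v < b" "\<And>x. x \<in> convex hull ?S \<Longrightarrow> b < w \<bullet> x"
      using separating_hyperplane_closed_point[OF convex_convex_hull] by blast
    \<comment> \<open>The hyperplane has \<open>v\<close> on its lower side, so arcs of small weight
      are wanted: hence \<open>- w\<close>.\<close>
    have "\<exists>a b. allowed_arcs j a b \<and> (\<Sum>i\<in>UNIV. - w $ i * q j i) \<le> (- w $ a + - w $ b) / 2" for j
      by (rule ex_allowed_arcs_ge[OF nonneg supp sum half])
    then have "\<forall>j. \<exists>a b. allowed_arcs j a b \<and> (w $ a + w $ b) / 2 \<le> (\<Sum>i\<in>UNIV. w $ i * q j i)"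
      by (simp add: sum_negf field_simps)
    then obtain f g where fg: "\<And>j. allowed_arcs j (f j) (g j)"
      "\<And>j. (w $ f j + w $ g j) / 2 \<le> (\<Sum>i\<in>UNIV. w $ i * q j i)"
      unfolding choice_iff by blast
    have "w \<bullet> digraph_vector (arc_choice f g) \<le> (\<Sum>j\<in>UNIV. \<Sum>i\<in>UNIV. w $ i * q j i) / real CARD('n)"
      unfolding inner_digraph_vector_arc_choice by (intro divide_right_mono sum_mono fg) auto
    also have "\<dots> = w \<bullet> v"
      by (subst sum.swap) (simp add: inner_vec_def v sum_distrib_left sum_divide_distrib)
    also have "\<dots> < b" by (rule w)
    also have "\<dots> < w \<bullet> digraph_vector (arc_choice f g)"
      using fg by (intro w(2) hull_inc) auto
    finally show False .
  qed
  also have "\<dots> \<subseteq> A_star"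
    unfolding A_star_def by (intro hull_mono) (auto intro!: imageI arc_choice_in_digraphs)
  finally show ?thesis .
qed

section \<open>Cancelling opposite flows\<close>

theorem theorem5p1:
  fixes T :: "'n::{finite,linorder} rules" and P :: "real ^ 'n::{finite,linorder} ^ 'n::{finite,linorder}"
  assumes "CARD('n) \<ge> 2"
    and "tournament T" and "symmetric T" and "honest T" and "frugal T"
    and "P \<in> doubly_monotonic"
  shows "win_vector T P \<in> A_star"
proof -
  obtain R where T: "T = Randomize (map_pmf R (pmf_of_set UNIV))"
    and excl: "\<And>k i j t u. state (R k) (Play i j t u) \<Longrightarrow> i \<noteq> k \<and> j \<noteq> k"
    using \<open>frugal T\<close> unfolding frugal_def by blast
  have T_state: "state T s" if "state (R k) s" for k s
    by (rule state_trans[OF that], rule state.random[of _ "map_pmf R (pmf_of_set UNIV)"])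
       (auto simp: T intro: state.start)
  interpret honest_frugal R
    using excl T_state \<open>honest T\<close> unfolding honest_def by unfold_locales blast+
  have PM: "P \<in> prob_matrices" using \<open>P \<in> doubly_monotonic\<close> by (simp add: doubly_monotonic_def)
  define F where "F k i = avg_win_prob R k P i" for k i
  have F0: "0 \<le> F k i" and F1: "(\<Sum>i\<in>UNIV. F k i) = 1" for k i
    by (simp_all add: F_def avg_win_prob_nonneg sum_avg_win_prob)
  have swap: "F i j \<le> F j i" if "i < j" for i j
    using avg_win_prob_swap_le[OF \<open>P \<in> doubly_monotonic\<close> that] by (simp add: F_def)
  \<comment> \<open>For \<open>i < j\<close> the flow from \<open>i\<close> to \<open>j\<close> is
    the smaller one by \<open>swap\<close>; that amount is cancelled and added to the loops at both
    \<open>i\<close> and \<open>j\<close>.\<close>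
  define q where "q j i = (if i < j then F j i - F i j else 0) +
    (if i = j then F j j + (\<Sum>l\<in>{..<j}. F l j) + (\<Sum>l\<in>{j<..}. F j l) else 0)" for j i
  have split: "(\<Sum>i\<in>UNIV. h i) = h j + (\<Sum>i\<in>{..<j}. h i) + (\<Sum>i\<in>{j<..}. h i)"
    for h :: "'n \<Rightarrow> real" and j
  proof -
    have U: "UNIV = insert j ({..<j} \<union> {j<..})" by auto
    show ?thesis unfolding U by (subst sum.insert) (auto intro!: sum.union_disjoint)
  qed
  have q_gt: "q j i = 0" if "j < i" for j i
    using that by (auto simp: q_def)
  have q_lt: "q j i = F j i - F i j" if "i < j" for j i
    using that by (auto simp: q_def)
  have q_eq: "q j j = F j j + (\<Sum>l\<in>{..<j}. F l j) + (\<Sum>l\<in>{j<..}. F j l)" for j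
    by (simp add: q_def)
  show ?thesis
  proof (rule mean_in_A_star)
    show "0 \<le> q j i" for j i
      using swap F0 by (auto simp: q_def intro!: add_nonneg_nonneg sum_nonneg)
    show "q j i = 0" if "j < i" for j i
      using that by (rule q_gt)
    show "(\<Sum>i\<in>UNIV. q j i) = 1" for j
      using F1[of j] unfolding split[of _ j] by (simp add: q_gt q_lt q_eq sum_subtractf)
    show "q j i \<le> 1/2" if "i \<noteq> Min UNIV" "i < j" for j i
      using avg_win_prob_le_half[OF \<open>P \<in> doubly_monotonic\<close> that(2,1)] that F0[of i j]
      by (simp add: q_lt) (simp add: F_def)
    show "win_vector T P $ i = (\<Sum>j\<in>UNIV. q j i) / real CARD('n)" for i
    proof -
      \<comment> \<open>The loop at \<open>i\<close> returns what the entries with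
        \<open>j > i\<close> subtract, and supplies the inflow from players below
        \<open>i\<close>.\<close>
      have "(\<Sum>j\<in>UNIV. q j i) = (\<Sum>k\<in>UNIV. F k i)"
        unfolding split[of _ i] by (simp add: q_gt q_lt q_eq sum_subtractf)
      then show ?thesis
        by (simp add: win_vector_def F_def win_prob_eq_avg[OF T \<open>symmetric T\<close> PM])
    qed
  qed
qed

end
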